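(* Let $A\in\mathbb{R}^{m\times n}$ with $2\le m<n$ be a matrix with nonzero columns. Suppose that one of the following conditions holds: (i) $\alpha(A)<\frac{1}{\mu(A)}$; (ii) $\alpha(A)\le\frac{1}{\mu(A)}$ and $\beta(A)<\alpha(A)$. Then $$1+\frac{2\left[1-\alpha(A)\beta(A)\widetilde{\mu}(A)^2\right]}{\mu^{(2)}(A)\left\{\widetilde{\mu}(A)(\alpha(A)+\beta(A))+\sqrt{\left[\widetilde{\mu}(A)(\alpha(A)-\beta(A))\right]^2+4}\right\}}\ >\ 1+\frac{1}{\mu(A)},$$ where $\widetilde{\mu}(A):=\mu(A)-\mu^{(2)}(A)$.
   Context: For a matrix $M\in\mathbb{R}^{m\times n}$ with nonzero columns $c_1,\dots,c_n$, put $g_{ij}=\frac{|c_i^Tc_j|}{\|c_i\|_2\|c_j\|_2}$. The mutual coherence is $\mu(M)=\max_{i\ne j}g_{ij}$. The sub-mutual coherence is $\mu^{(2)}(M)=\max\{g_{ij}: i\ne j,\ g_{ij}<\mu(M)\}$, the second largest distinct value among the $g_{ij}$, $i\neq j$ (convention: $0$ if this set is empty). It is known that $\mu^{(2)}(A)>0$ under condition (i) or (ii) of the claim. For $i=1,\dots,n$ let $\alpha_i(M)=|\{j: j\ne i,\ g_{ij}=\mu(M)\}|$. The coherence rank is $\alpha(M)=\max_{1\le i\le n}\alpha_i(M)$; let $i_0$ be an index with $\alpha_{i_0}(M)=\alpha(M)$; the sub-coherence rank is $\beta(M)=\max_{i\ne i_0}\alpha_i(M)$ (independent of the choice of $i_0$).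 *)

theory Defs
  imports "HOL-Analysis.Analysis"
begin

definition col_coherence :: "real^'n^'m \<Rightarrow> 'n \<Rightarrow> 'n \<Rightarrow> real" where
  "col_coherence M i j =
     \<bar>column i M \<bullet> column j M\<bar> / (norm (column i M) * norm (column j M))"

text \<open>The maxima below range over finite sets that are nonempty once \<open>M\<close> has at least two columns.\<close>

definition mutual_coherence :: "real^'n^'m \<Rightarrow> real" where
  "mutual_coherence M = Max {col_coherence M i j | i j. i \<noteq> j}"

definition sub_mutual_coherence :: "real^'n^'m \<Rightarrow> real" where
  "sub_mutual_coherence M =
     (let S = {col_coherence M i j | i j. i \<noteq> j \<and> col_coherence M i j < mutual_coherence M}
      in if S = {} then 0 else Max S)"

definition coherence_count :: "real^'n^'m \<Rightarrow> 'n \<Rightarrow> nat" where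
  "coherence_count M i = card {j. j \<noteq> i \<and> col_coherence M i j = mutual_coherence M}"

definition coherence_rank :: "real^'n^'m \<Rightarrow> nat" where
  "coherence_rank M = Max (range (coherence_count M))"

text \<open>One index attaining the coherence rank is removed, so the sub-coherence rank equals the
  coherence rank when the maximum is attained twice. The choice of index is immaterial:
  see \<open>sub_coherence_rank_eq\<close>.\<close>

definition sub_coherence_rank :: "real^'n^'m \<Rightarrow> nat" where
  "sub_coherence_rank M =
     (let i0 = (SOME i. coherence_count M i = coherence_rank M)
      in Max (coherence_count M ` (UNIV - {i0})))"

lemma coherence_rank_attained: "\<exists>i. coherence_count M i = coherence_rank M"
proof -
  have "Max (range (coherence_count M)) \<in> range (coherence_count M)"
    by (rule Max_in) auto
  then show ?thesis
    unfolding coherence_rank_def by (metis imageE)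
qed

lemma sub_coherence_rank_eq:
  fixes M :: "real^'n^'m"
  assumes "coherence_count M i0 = coherence_rank M"
  shows "sub_coherence_rank M = Max (coherence_count M ` (UNIV - {i0}))"
proof -
  let ?c = "coherence_count M"
  define k where "k = (SOME i. ?c i = coherence_rank M)"
  have k: "?c k = ?c i0"
    using someI_ex[OF coherence_rank_attained[of M]] assms unfolding k_def by simp
  have "?c ` (UNIV - {k}) = ?c ` (UNIV - {i0})"
  proof (cases "k = i0")
    case False
    have "?c ` (UNIV - {k}) = insert (?c i0) (?c ` (UNIV - {k, i0}))"
      using False by auto
    moreover have "?c ` (UNIV - {i0}) = insert (?c k) (?c ` (UNIV - {k, i0}))"
      using False by auto
    ultimately show ?thesis using k by simp
  qed simp
  then show ?thesis
    by (simp add: sub_coherence_rank_def k_def Let_def)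
qed

end

theory Submission
  imports Defs
begin

text \<open>
  Write \<open>t = \<mu> - \<mu>2\<close>, \<open>r = \<mu>2 / \<mu>\<close>, \<open>p = t (\<alpha> + \<beta>)\<close> and \<open>S\<close> for the square root.
  Since \<open>(S - p) (S + p) = 4 (1 - \<alpha> \<beta> t\<^sup>2)\<close>, the fraction on the left equals
  \<open>(S - p) / (2 \<mu>2)\<close>, so the claim is \<open>S > 2 r + p\<close>. Squaring turns this into
  \<open>(r + t \<alpha>) (r + t \<beta>) < 1\<close>. As \<open>1 - r = t / \<mu>\<close>, a factor \<open>r + t a\<close> is at most (less than) 1
  exactly when \<open>a\<close> is at most (less than) \<open>1 / \<mu>\<close>. As \<open>\<beta> \<le> \<alpha>\<close>, either
  hypothesis gives \<open>\<alpha> \<le> 1 / \<mu>\<close> and \<open>\<beta> < 1 / \<mu>\<close>, so the product is less than 1. This is \<open>coherence_bound_inequality\<close>.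

  The argument needs \<open>0 < \<mu>2 < \<mu>\<close>, and the substance is \<open>0 < \<mu>2\<close>. With more columns than rows,
  the columns are linearly dependent; after normalising them, the coefficients \<open>y\<close> of a
  dependency satisfy \<open>\<bar>y\<^sub>i\<bar> \<le> (\<Sum>j\<noteq>i. g\<^sub>i\<^sub>j \<bar>y\<^sub>j\<bar>)\<close> for the column coherences \<open>g\<close>
  (\<open>dependency_dominated_by_coherence\<close>). If \<open>\<mu>2\<close> were 0, every \<open>g\<^sub>i\<^sub>j\<close> would be 0 or \<open>\<mu>\<close>,
  so row \<open>i\<close> would have off-diagonal sum \<open>\<mu> \<alpha>\<^sub>i\<close>, which is at most 1 by hypothesis, with equality
  in at most one row. Such a Gram matrix is nonsingular by a diagonal dominance argument
  (\<open>dominated_vector_trivial\<close>), contradicting the dependency.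
\<close>

section \<open>Dependent columns and diagonal dominance\<close>

lemma col_coherence_nonneg: "0 \<le> col_coherence M i j"
  by (simp add: col_coherence_def)

lemma dependency_dominated_by_coherence:
  fixes A :: "real^'n^'m"
  assumes card: "CARD('m) < CARD('n)" and nz: "\<forall>i. column i A \<noteq> 0"
  obtains y :: "'n \<Rightarrow> real" where "\<exists>i. y i \<noteq> 0"
    and "\<And>i. \<bar>y i\<bar> \<le> (\<Sum>j\<in>UNIV - {i}. col_coherence A i j * \<bar>y j\<bar>)"
proof -
  have "rank A < CARD('n)"
    using rank_bound[of A] card by linarith
  then obtain x where x: "x \<noteq> 0" "A *v x = 0"
    using less_rank_noninjective[of A] matrix_left_invertible_ker matrix_left_invertible_injective
    by metis
  define y where "y i = x $ i * norm (column i A)" for i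
  have "\<exists>i. y i \<noteq> 0"
    using x nz by (auto simp: y_def vec_eq_iff)
  moreover have "\<bar>y i\<bar> \<le> (\<Sum>j\<in>UNIV - {i}. col_coherence A i j * \<bar>y j\<bar>)" for i
  proof -
    let ?c = "\<lambda>i. column i A"
    let ?h = "\<lambda>j. (?c i \<bullet> ?c j) / (norm (?c i) * norm (?c j))"
    have "0 = ?c i \<bullet> (A *v x)"
      by (simp add: x)
    also have "\<dots> = (\<Sum>j\<in>UNIV. x $ j * (?c i \<bullet> ?c j))"
      by (simp add: matrix_mult_sum inner_sum_right scalar_mult_eq_scaleR)
    also have "\<dots> = (\<Sum>j\<in>UNIV. norm (?c i) * (?h j * y j))"
      using nz by (intro sum.cong) (auto simp: y_def)
    also have "\<dots> = norm (?c i) * (\<Sum>j\<in>UNIV. ?h j * y j)"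
      by (simp add: sum_distrib_left)
    finally have "(\<Sum>j\<in>UNIV. ?h j * y j) = 0"
      using nz by simp
    moreover have "?h i = 1"
      using nz by (simp add: dot_square_norm power2_eq_square)
    ultimately have "y i = - (\<Sum>j\<in>UNIV - {i}. ?h j * y j)"
      by (simp add: sum.remove[where x = i])
    then have "\<bar>y i\<bar> \<le> (\<Sum>j\<in>UNIV - {i}. \<bar>?h j * y j\<bar>)"
      by (simp only: abs_minus_cancel sum_abs)
    then show ?thesis
      by (simp add: col_coherence_def abs_mult)
  qed
  ultimately show ?thesis
    using that by blast
qed

text \<open>
  Diagonal dominance that may degenerate to equality in one row. If \<open>y \<noteq> 0\<close>, an index where \<open>\<bar>y\<bar>\<close> is largest
  must lie in the degenerate row \<open>k\<close>; then \<open>\<bar>y\<bar>\<close> is strictly smaller at all other indices, so the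
  estimate of row \<open>k\<close> is strict after all.
\<close>

lemma dominated_vector_trivial:
  fixes g :: "'n::finite \<Rightarrow> 'n \<Rightarrow> real"
  assumes nonneg: "\<And>i j. 0 \<le> g i j"
    and dominated: "\<And>i. \<bar>y i\<bar> \<le> (\<Sum>j\<in>UNIV - {i}. g i j * \<bar>y j\<bar>)"
    and le: "(\<Sum>j\<in>UNIV - {k}. g k j) \<le> 1"
    and less: "\<And>i. i \<noteq> k \<Longrightarrow> (\<Sum>j\<in>UNIV - {i}. g i j) < 1"
  shows "y i = 0"
proof (rule ccontr)
  assume "y i \<noteq> 0"
  define m where "m = Max (range (\<lambda>j. \<bar>y j\<bar>))"
  have le_m: "\<bar>y j\<bar> \<le> m" for j
    by (simp add: m_def)
  have "0 < m"
    using le_m[of i] \<open>y i \<noteq> 0\<close> by linarith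
  have row: "\<bar>y j\<bar> \<le> (\<Sum>l\<in>UNIV - {j}. g j l) * m" for j
  proof -
    note dominated[of j]
    also have "(\<Sum>l\<in>UNIV - {j}. g j l * \<bar>y l\<bar>) \<le> (\<Sum>l\<in>UNIV - {j}. g j l * m)"
      by (intro sum_mono mult_left_mono le_m nonneg)
    finally show ?thesis
      by (simp add: sum_distrib_right)
  qed
  have small: "\<bar>y j\<bar> < m" if "j \<noteq> k" for j
    using row[of j] mult_strict_right_mono[OF less[OF that] \<open>0 < m\<close>] by linarith
  have "m \<in> range (\<lambda>j. \<bar>y j\<bar>)"
    unfolding m_def by (rule Max_in) auto
  then have yk: "\<bar>y k\<bar> = m"
    using small by (metis imageE less_irrefl)
  \<comment> \<open>Row \<open>k\<close> has a nonzero off-diagonal entry, as otherwise \<open>m \<le> 0\<close>; there the strict bound is effective.\<close>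
  obtain l where l: "l \<noteq> k" "g k l \<noteq> 0"
  proof (rule ccontr)
    assume "\<not> thesis"
    then have "\<forall>l\<in>UNIV - {k}. g k l = 0"
      using that by blast
    then have "(\<Sum>j\<in>UNIV - {k}. g k j * \<bar>y j\<bar>) = 0"
      by simp
    then show False
      using dominated[of k] yk \<open>0 < m\<close> by simp
  qed
  have "(\<Sum>j\<in>UNIV - {k}. g k j * \<bar>y j\<bar>) < (\<Sum>j\<in>UNIV - {k}. g k j * m)"
  proof (rule sum_strict_mono_ex1)
    show "\<forall>j\<in>UNIV - {k}. g k j * \<bar>y j\<bar> \<le> g k j * m"
      by (intro ballI mult_left_mono le_m nonneg)
    have "0 < g k l"
      using l nonneg[of k l] by linarith
    then show "\<exists>j\<in>UNIV - {k}. g k j * \<bar>y j\<bar> < g k j * m"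
      using l small[of l] by (intro bexI[of _ l]) auto
  qed simp
  also have "\<dots> \<le> 1 * m"
    unfolding sum_distrib_right[symmetric] using le \<open>0 < m\<close> by (intro mult_right_mono) auto
  finally show False
    using dominated[of k] yk by linarith
qed

section \<open>Positivity of the coherence and the sub-coherence\<close>

lemma finite_col_coherence_values:
  fixes M :: "real^'n^'m"
  shows "finite {col_coherence M i j | i j. P i j}"
proof (rule finite_subset)
  show "{col_coherence M i j | i j. P i j} \<subseteq> range (\<lambda>(i, j). col_coherence M i j)"
    by auto
  show "finite (range (\<lambda>(i, j). col_coherence M i j))"
    by simp
qed

lemma col_coherence_le_mutual:
  fixes M :: "real^'n^'m"
  assumes "i \<noteq> j"
  shows "col_coherence M i j \<le> mutual_coherence M"
  unfolding mutual_coherence_def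
  by (rule Max_ge[OF finite_col_coherence_values]) (use assms in blast)

lemma mutual_coherence_pos:
  fixes A :: "real^'n^'m"
  assumes "CARD('m) < CARD('n)" and "\<forall>i. column i A \<noteq> 0"
  shows "0 < mutual_coherence A"
proof (rule ccontr)
  assume "\<not> 0 < mutual_coherence A"
  then have zero: "col_coherence A i j = 0" if "i \<noteq> j" for i j
    using col_coherence_le_mutual[OF that, of A] col_coherence_nonneg[of A i j] by linarith
  obtain y :: "'n \<Rightarrow> real" where y: "\<exists>i. y i \<noteq> 0"
    and dom: "\<And>i. \<bar>y i\<bar> \<le> (\<Sum>j\<in>UNIV - {i}. col_coherence A i j * \<bar>y j\<bar>)"
    using dependency_dominated_by_coherence[OF assms] by blast
  have "(\<Sum>j\<in>UNIV - {i}. col_coherence A i j * \<bar>y j\<bar>) = 0" for i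
    by (rule sum.neutral) (auto simp: zero)
  then show False
    using y dom by (metis abs_le_zero_iff)
qed

lemma col_coherence_le_sub_mutual:
  fixes M :: "real^'n^'m"
  assumes "i \<noteq> j" and "col_coherence M i j < mutual_coherence M"
  shows "col_coherence M i j \<le> sub_mutual_coherence M"
proof -
  let ?S = "{col_coherence M i j | i j. i \<noteq> j \<and> col_coherence M i j < mutual_coherence M}"
  have "finite ?S"
    by (rule finite_col_coherence_values)
  moreover have "col_coherence M i j \<in> ?S"
    using assms by blast
  ultimately show ?thesis
    unfolding sub_mutual_coherence_def Let_def by (auto intro: Max_ge)
qed

lemma sub_mutual_coherence_less:
  fixes M :: "real^'n^'m"
  assumes "0 < mutual_coherence M"
  shows "sub_mutual_coherence M < mutual_coherence M"
proof -
  let ?S = "{col_coherence M i j | i j. i \<noteq> j \<and> col_coherence M i j < mutual_coherence M}"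
  have "Max ?S < mutual_coherence M" if "?S \<noteq> {}"
    using Max_in[OF finite_col_coherence_values that] by (elim CollectE exE conjE) (simp only:)
  then show ?thesis
    unfolding sub_mutual_coherence_def Let_def using assms by (simp only: split: if_split) simp
qed

lemma coherence_count_le_rank: "coherence_count M i \<le> coherence_rank M"
  by (simp add: coherence_rank_def)

lemma coherence_count_le_sub_rank:
  assumes "coherence_count M k = coherence_rank M" and "i \<noteq> k"
  shows "coherence_count M i \<le> sub_coherence_rank M"
  unfolding sub_coherence_rank_eq[OF assms(1)] using assms(2) by (intro Max_ge) auto

lemma sub_coherence_rank_le:
  fixes M :: "real^'n^'m"
  assumes "1 < CARD('n)"
  shows "sub_coherence_rank M \<le> coherence_rank M"
proof -
  obtain k where k: "coherence_count M k = coherence_rank M"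
    using coherence_rank_attained by blast
  have "UNIV - {k} \<noteq> {}"
  proof
    assume "UNIV - {k} = {}"
    then have "card (UNIV :: 'n set) \<le> card {k}"
      by (intro card_mono) auto
    then show False using assms by simp
  qed
  then show ?thesis
    unfolding sub_coherence_rank_eq[OF k] by (auto simp: coherence_count_le_rank)
qed

text \<open>
  If the sub-coherence is not positive, the only off-diagonal values are 0 and \<open>\<mu>\<close>.
\<close>

lemma coherence_row_sum:
  fixes A :: "real^'n^'m"
  assumes "sub_mutual_coherence A \<le> 0"
  shows "(\<Sum>j\<in>UNIV - {i}. col_coherence A i j)
           = real (coherence_count A i) * mutual_coherence A"
proof -
  let ?\<mu> = "mutual_coherence A"
  have "col_coherence A i j = (if col_coherence A i j = ?\<mu> then ?\<mu> else 0)" if "j \<noteq> i" for j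
    using col_coherence_le_mutual[of i j A] col_coherence_le_sub_mutual[of i j A]
      col_coherence_nonneg[of A i j] assms that by fastforce
  then have "(\<Sum>j\<in>UNIV - {i}. col_coherence A i j)
      = (\<Sum>j\<in>UNIV - {i}. if col_coherence A i j = ?\<mu> then ?\<mu> else 0)"
    by (intro sum.cong) auto
  also have "\<dots> = (\<Sum>j\<in>{j. j \<noteq> i \<and> col_coherence A i j = ?\<mu>}. ?\<mu>)"
    by (intro sum.mono_neutral_cong_right) auto
  finally show ?thesis
    by (simp add: coherence_count_def)
qed

lemma sub_mutual_coherence_pos:
  fixes A :: "real^'n^'m"
  assumes card: "CARD('m) < CARD('n)" and nz: "\<forall>i. column i A \<noteq> 0"
    and le: "real (coherence_rank A) * mutual_coherence A \<le> 1"
    and less: "real (sub_coherence_rank A) * mutual_coherence A < 1"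
  shows "0 < sub_mutual_coherence A"
proof (rule ccontr)
  assume "\<not> 0 < sub_mutual_coherence A"
  then have sums: "(\<Sum>j\<in>UNIV - {i}. col_coherence A i j)
      = real (coherence_count A i) * mutual_coherence A" for i
    by (intro coherence_row_sum) simp
  obtain y :: "'n \<Rightarrow> real" where y: "\<exists>i. y i \<noteq> 0"
    and dom: "\<And>i. \<bar>y i\<bar> \<le> (\<Sum>j\<in>UNIV - {i}. col_coherence A i j * \<bar>y j\<bar>)"
    using dependency_dominated_by_coherence[OF card nz] by blast
  obtain k where k: "coherence_count A k = coherence_rank A"
    using coherence_rank_attained by blast
  have "real (coherence_count A i) * mutual_coherence A < 1" if "i \<noteq> k" for i
  proof -
    have "real (coherence_count A i) * mutual_coherence A
        \<le> real (sub_coherence_rank A) * mutual_coherence A"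
      using coherence_count_le_sub_rank[OF k that] mutual_coherence_pos[OF card nz]
      by (intro mult_right_mono) auto
    then show ?thesis using less by linarith
  qed
  then have "y i = 0" for i
    by (intro dominated_vector_trivial[of "col_coherence A" y k])
      (use le dom in \<open>simp_all add: sums k col_coherence_nonneg\<close>)
  then show False using y by blast
qed

section \<open>The inequality between the two bounds\<close>

lemma coherence_bound_inequality:
  fixes \<mu> \<nu> a b :: real
  defines "t \<equiv> \<mu> - \<nu>"
  assumes \<nu>: "0 < \<nu>" "\<nu> < \<mu>" and nonneg: "0 \<le> a" "0 \<le> b"
    and a: "a * \<mu> \<le> 1" and b: "b * \<mu> < 1"
  shows "1 / \<mu> < 2 * (1 - a * b * t\<^sup>2) / (\<nu> * (t * (a + b) + sqrt ((t * (a - b))\<^sup>2 + 4)))"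
proof -
  define r where "r = \<nu> / \<mu>"
  define p where "p = t * (a + b)"
  define S where "S = sqrt ((t * (a - b))\<^sup>2 + 4)"
  have pos: "0 < \<mu>" "0 < t" "0 < r" "0 \<le> p"
    using \<nu> nonneg by (auto simp: t_def r_def p_def)
  have \<mu>r: "\<mu> * r = \<nu>"
    using pos by (simp add: r_def)
  have "\<mu> * (r + t * a) = \<nu> + t * (a * \<mu>)"
    by (simp add: distrib_left \<mu>r)
  also have "\<dots> \<le> \<mu> * 1"
    using mult_left_mono[OF a, of t] pos t_def by linarith
  finally have le: "r + t * a \<le> 1"
    using pos by simp
  have "\<mu> * (r + t * b) = \<nu> + t * (b * \<mu>)"
    by (simp add: distrib_left \<mu>r)
  also have "\<dots> < \<mu> * 1"
    using mult_strict_left_mono[OF b, of t] pos t_def by linarith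
  finally have less: "r + t * b < 1"
    using pos by simp
  have "0 < r + t * b"
    using pos nonneg by (simp add: add_pos_nonneg)
  then have "(r + t * a) * (r + t * b) \<le> 1 * (r + t * b)"
    by (intro mult_right_mono le) simp
  also have "\<dots> < 1"
    using less by simp
  finally have "(r + t * a) * (r + t * b) < 1" .
  moreover have "(2 * r + p)\<^sup>2 = 4 * ((r + t * a) * (r + t * b)) + (t * (a - b))\<^sup>2"
    by (simp add: p_def power2_eq_square algebra_simps)
  ultimately have "2 * r + p < S"
    unfolding S_def by (intro real_less_rsqrt) linarith
  then have S: "2 * r < S - p" "0 < S + p"
    using pos by auto
  have "S\<^sup>2 = (t * (a - b))\<^sup>2 + 4"
    by (simp add: S_def)
  then have prod: "(S - p) * (S + p) = 4 * (1 - a * b * t\<^sup>2)"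
    by (simp add: p_def power2_eq_square algebra_simps)
  have "\<nu> * (p + S) = \<mu> * (r * (S + p))"
    by (simp add: \<mu>r[symmetric] algebra_simps)
  also have "\<dots> < \<mu> * (2 * (1 - a * b * t\<^sup>2))"
    using mult_strict_right_mono[OF S] prod pos by (intro mult_strict_left_mono) auto
  finally have "\<nu> * (p + S) < \<mu> * (2 * (1 - a * b * t\<^sup>2))" .
  moreover have "0 < \<nu> * (p + S)"
    using \<nu> S by simp
  ultimately show ?thesis
    using pos unfolding p_def[symmetric] S_def[symmetric] by (simp add: field_simps)
qed

theorem corollary2p7:
  fixes A :: "real^'n^'m"
    and \<mu> \<mu>2 \<mu>t :: real and \<alpha> \<beta> :: nat
  defines "\<mu> \<equiv> mutual_coherence A"
    and "\<mu>2 \<equiv> sub_mutual_coherence A"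
    and "\<mu>t \<equiv> \<mu> - \<mu>2"
    and "\<alpha> \<equiv> coherence_rank A"
    and "\<beta> \<equiv> sub_coherence_rank A"
  assumes "2 \<le> CARD('m)" and "CARD('m) < CARD('n)"
    and "\<forall>i. column i A \<noteq> 0"
    and "real \<alpha> < 1 / \<mu> \<or> (real \<alpha> \<le> 1 / \<mu> \<and> \<beta> < \<alpha>)"
  shows "1 + 2 * (1 - real \<alpha> * real \<beta> * \<mu>t\<^sup>2) /
               (\<mu>2 * (\<mu>t * (real \<alpha> + real \<beta>) + sqrt ((\<mu>t * (real \<alpha> - real \<beta>))\<^sup>2 + 4)))
         > 1 + 1 / \<mu>"
proof -
  have \<mu>: "0 < \<mu>"
    unfolding \<mu>_def by (rule mutual_coherence_pos) fact+
  have "1 < CARD('n)"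
    using assms(6,7) by linarith
  then have "\<beta> \<le> \<alpha>"
    unfolding \<alpha>_def \<beta>_def by (rule sub_coherence_rank_le)
  then have "real \<alpha> \<le> 1 / \<mu>" and "real \<beta> < 1 / \<mu>"
    using assms(9) by auto
  then have ranks: "real \<alpha> * \<mu> \<le> 1" "real \<beta> * \<mu> < 1"
    using \<mu> by (auto simp: field_simps)
  have "0 < \<mu>2"
    unfolding \<mu>2_def
    by (rule sub_mutual_coherence_pos) (use assms(7,8) ranks in \<open>simp_all add: \<mu>_def \<alpha>_def \<beta>_def\<close>)
  moreover have "\<mu>2 < \<mu>"
    using \<mu> unfolding \<mu>_def \<mu>2_def by (rule sub_mutual_coherence_less)
  ultimately show ?thesis
    using coherence_bound_inequality[of \<mu>2 \<mu> "real \<alpha>" "real \<beta>"] ranks by (simp add: \<mu>t_def)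
qed

end
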